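(* Let $m\geq 1$ and $b\geq 2$ be integers, let $\underline{\theta}\in\mathbb{R}^m$, and let $\mathcal{T}$ be any countable union of affine hyperplanes in $\mathbb{R}^m$. Then for every $w\in[0,1)$, \[ \dim_H\big(\mathcal{S}_{m,\underline{\theta}}(w)\setminus\mathcal{T}\big)\ \geq\ \dim_H\big(\mathcal{S}^{(b)}_{m,\underline{\theta}}(w)\setminus\mathcal{T}\big)\ \geq\ m\left(\frac{1-w}{1+w}\right)^2 . \] In particular, \[ \dim_H\big(\mathcal{S}_{m,\underline{\theta}}(1/m)\setminus\mathcal{T}\big)\ \geq\ \dim_H\big(\mathcal{S}^{(b)}_{m,\underline{\theta}}(1/m)\setminus\mathcal{T}\big)\ \geq\ m\left(1-\frac{2}{m+1}\right)^2 . \]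
   Context: Fix an arbitrary norm $\Vert\cdot\Vert$ on $\mathbb{R}^m$. For $\underline{\theta}\in\mathbb{R}^m$ and $w\geq 0$, $\mathcal{S}_{m,\underline{\theta}}(w)$ is the set of $\underline{x}\in\mathbb{R}^m$ such that for every $c>0$ there is $Q_0$ such that for all $Q\geq Q_0$ the system $1\leq q\leq Q$, $\Vert q\underline{x}-\underline{p}-\underline{\theta}\Vert\leq cQ^{-w}$ has a solution in integers $q\in\mathbb{Z}$, $\underline{p}\in\mathbb{Z}^m$. The $b$-ary set $\mathcal{S}^{(b)}_{m,\underline{\theta}}(w)$ is defined the same way except that $q$ is restricted to powers $q=b^N$ with $N$ a positive integer. $\dim_H$ denotes Hausdorff dimension. *)

theory Defs
  imports "HOL-Analysis.Analysis"
begin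

text \<open>The contribution diam(U)^s of a covering set, with the conventions that the empty set
  contributes 0 and that 0^0 = 1 (whereas \<^term>\<open>(0::real) powr 0\<close> is 0 in the library), so
  that for s = 0 one gets counting measure.\<close>

definition diam_pow :: "real \<Rightarrow> 'a::metric_space set \<Rightarrow> ennreal" where
  "diam_pow s U =
     (if U = {} then 0 else if s = 0 then 1 else ennreal (diameter U powr s))"

text \<open>Boundedness of the covering sets is required explicitly because \<^const>\<open>diameter\<close> is
  real-valued and unspecified on unbounded sets.  The sets may be empty, so finite covers are
  included.\<close>

definition hausdorff_content :: "real \<Rightarrow> real \<Rightarrow> 'a::metric_space set \<Rightarrow> ennreal" where
  "hausdorff_content s \<delta> A =
     (INF U \<in> {U :: nat \<Rightarrow> 'a set. A \<subseteq> (\<Union>i. U i) \<and>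
                  (\<forall>i. bounded (U i) \<and> diameter (U i) \<le> \<delta>)}.
        (\<Sum>i. diam_pow s (U i)))"

definition hausdorff_measure :: "real \<Rightarrow> 'a::metric_space set \<Rightarrow> ennreal" where
  "hausdorff_measure s A = (SUP \<delta> \<in> {0<..}. hausdorff_content s \<delta> A)"

text \<open>Extended-real valued; the empty set has dimension 0.\<close>

definition hausdorff_dim :: "'a::metric_space set \<Rightarrow> ereal" where
  "hausdorff_dim A = (INF s \<in> {s. 0 \<le> s \<and> hausdorff_measure s A = 0}. ereal s)"

text \<open>An arbitrary norm on a real vector space, as opposed to the type's own (on
  \<^typ>\<open>real ^ 'm\<close>: Euclidean) norm; nonnegativity follows from the three axioms.\<close>

definition is_norm :: "('a::real_vector \<Rightarrow> real) \<Rightarrow> bool" where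
  "is_norm \<nu> \<longleftrightarrow>
     (\<forall>x. \<nu> x = 0 \<longleftrightarrow> x = 0) \<and>
     (\<forall>a x. \<nu> (a *\<^sub>R x) = \<bar>a\<bar> * \<nu> x) \<and>
     (\<forall>x y. \<nu> (x + y) \<le> \<nu> x + \<nu> y)"

definition affine_hyperplane :: "'a::euclidean_space set \<Rightarrow> bool" where
  "affine_hyperplane H \<longleftrightarrow> (\<exists>a c. a \<noteq> 0 \<and> H = {x. a \<bullet> x = c})"

definition int_vec :: "int ^ 'm \<Rightarrow> real ^ 'm" where
  "int_vec p = (\<chi> i. real_of_int (p $ i))"

text \<open>The set of x that are uniformly approximable with exponent w by means of denominators q
  taken from K.  The norm \<open>\<nu>\<close> is an argument, \<open>\<theta>\<close> is the inhomogeneous shift, and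
  Q ranges over the reals.\<close>

definition singular_set_on ::
  "int set \<Rightarrow> (real ^ 'm \<Rightarrow> real) \<Rightarrow> real ^ 'm \<Rightarrow> real \<Rightarrow> (real ^ 'm) set" where
  "singular_set_on K \<nu> \<theta> w =
     {x. \<forall>c>0. \<exists>Q0::real. \<forall>Q\<ge>Q0.
           \<exists>q\<in>K. \<exists>p :: int ^ 'm.
             1 \<le> q \<and> real_of_int q \<le> Q \<and>
             \<nu> (real_of_int q *\<^sub>R x - int_vec p - \<theta>) \<le> c * Q powr (- w)}"

definition singular_set ::
  "(real ^ 'm \<Rightarrow> real) \<Rightarrow> real ^ 'm \<Rightarrow> real \<Rightarrow> (real ^ 'm) set" where
  "singular_set = singular_set_on UNIV"

definition singular_set_base ::
  "nat \<Rightarrow> (real ^ 'm \<Rightarrow> real) \<Rightarrow> real ^ 'm \<Rightarrow> real \<Rightarrow> (real ^ 'm) set" where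
  "singular_set_base b = singular_set_on {int b ^ N | N :: nat. 1 \<le> N}"

end

theory Submission
  imports Defs "HOL-Real_Asymp.Real_Asymp"
begin

text \<open>
  Cut the base-\<open>b\<close> digit positions into blocks starting at \<open>N\<^sub>k \<approx> \<lambda>\<^sup>k\<close> with \<open>\<lambda> = 2 / (1 - w)\<close>. If the
  first \<open>L\<^sub>k \<approx> w N\<^sub>k\<^sub>+\<^sub>1 + k\<close> digits of each coordinate after position \<open>N\<^sub>k\<close> agree with those of
  \<open>\<theta>\<close>, then \<open>q = b\<close> to the power \<open>N\<^sub>k\<close> serves all \<open>Q\<close> up to the power \<open>N\<^sub>k\<^sub>+\<^sub>1\<close>. The other digits are
  free, and their lower density is \<open>((1 - w) / (1 + w))\<^sup>2\<close>. Filling the free positions with the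
  digits of \<open>t \<in> [0, 1)\<close>, coordinate by coordinate, gives a map of the unit cube into the singular set whose
  inverse is Hoelder with every exponent below this density, so images of sets of positive
  outer Lebesgue measure have dimension at least \<open>m\<close> times the density. The map is
  injective in each coordinate, so the preimage of an affine hyperplane meets the lines in some
  coordinate direction at most once and is therefore Lebesgue null; the countably many
  hyperplanes can be removed from the cube beforehand.
\<close>

section \<open>Hausdorff dimension and Lebesgue null sets\<close>

lemma hausdorff_dim_mono:
  assumes "A \<subseteq> B"
  shows "hausdorff_dim A \<le> hausdorff_dim B"
proof -
  have content: "hausdorff_content s \<delta> A \<le> hausdorff_content s \<delta> B" for s \<delta>
    unfolding hausdorff_content_def by (rule INF_superset_mono) (use assms in auto)
  have "hausdorff_measure s A \<le> hausdorff_measure s B" for s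
    unfolding hausdorff_measure_def by (intro SUP_mono) (use content in blast)
  then have "hausdorff_measure s B = 0 \<Longrightarrow> hausdorff_measure s A = 0" for s
    by (metis le_zero_eq)
  then show ?thesis
    unfolding hausdorff_dim_def by (intro INF_superset_mono) auto
qed

lemma hausdorff_dim_nonneg: "0 \<le> hausdorff_dim A"
  unfolding hausdorff_dim_def by (rule INF_greatest) auto

lemma hausdorff_measure_zeroE:
  fixes A :: "'a::metric_space set"
  assumes "hausdorff_measure s A = 0" and "\<delta> > 0" and "e > 0"
  obtains U :: "nat \<Rightarrow> 'a set" where "A \<subseteq> (\<Union>i. U i)" "\<And>i. bounded (U i)" "\<And>i. diameter (U i) \<le> \<delta>"
    "(\<Sum>i. diam_pow s (U i)) < e"
proof -
  have "hausdorff_content s \<delta> A \<le> hausdorff_measure s A"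
    unfolding hausdorff_measure_def by (rule SUP_upper) (use assms in auto)
  then have "hausdorff_content s \<delta> A < e" using assms by simp
  then show ?thesis
    unfolding hausdorff_content_def INF_less_iff using that by blast
qed

text \<open>Were the dimension smaller, the \<open>s\<close>-measure of the image would vanish for
  some \<open>s < \<alpha> * DIM('a)\<close>. Covering sets of diameter \<open>d\<close> pull back
  into balls of radius \<open>K * d powr \<alpha>\<close>, whose volume is at most a constant times
  \<open>d powr s\<close> when \<open>d \<le> 1\<close>, so \<open>T\<close> would be null.\<close>

lemma hausdorff_dim_image_ge:
  fixes f :: "'a::euclidean_space \<Rightarrow> 'b::metric_space"
  assumes "\<alpha> > 0" and "K \<ge> 0"
    and hol: "\<And>t t'. t \<in> T \<Longrightarrow> t' \<in> T \<Longrightarrow> dist t t' \<le> K * dist (f t) (f t') powr \<alpha>"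
    and T: "\<not> negligible T"
  shows "hausdorff_dim (f ` T) \<ge> ereal (\<alpha> * DIM('a))"
proof (rule ccontr)
  assume "\<not> ?thesis"
  then obtain s where s: "0 \<le> s" "s < \<alpha> * DIM('a)" "hausdorff_measure s (f ` T) = 0"
    unfolding hausdorff_dim_def not_le INF_less_iff by auto
  define V where "V = unit_ball_vol (DIM('a)) * K ^ DIM('a)"
  have V0: "V \<ge> 0" unfolding V_def using assms by simp
  have "negligible T" unfolding negligible_outer_le
  proof (intro allI impI)
    fix e :: real assume e: "e > 0"
    \<comment> \<open>The added 1 keeps \<open>e'\<close> positive even if
      \<open>V = 0\<close>.\<close>
    define e' where "e' = e / (V + 1)"
    have e': "e' > 0" "V * e' \<le> e" using e V0 unfolding e'_def by (auto simp: field_simps)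
    obtain U :: "nat \<Rightarrow> 'b set" where U: "f ` T \<subseteq> (\<Union>i. U i)" "\<And>i. bounded (U i)" "\<And>i. diameter (U i) \<le> 1"
      "(\<Sum>i. diam_pow s (U i)) < ennreal e'"
      by (rule hausdorff_measure_zeroE[OF s(3), of 1 "ennreal e'"]) (use e' in auto)
    have "\<exists>W. T \<inter> f -` U i \<subseteq> W \<and> W \<in> sets lebesgue \<and> emeasure lebesgue W \<le> ennreal V * diam_pow s (U i)" for i
    proof (cases "T \<inter> f -` U i = {}")
      case True then show ?thesis by (intro exI[of _ "{}"]) auto
    next
      case False
      then obtain t where t: "t \<in> T" "f t \<in> U i" by auto
      let ?d = "diameter (U i)"
      have d: "0 \<le> ?d" "?d \<le> 1" using U diameter_ge_0 by blast+
      define W where "W = cball t (K * ?d powr \<alpha>)"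
      have sub: "T \<inter> f -` U i \<subseteq> W"
      proof
        fix t' assume t': "t' \<in> T \<inter> f -` U i"
        have "dist (f t) (f t') \<le> ?d"
          using diameter_bounded_bound[OF U(2)] t t' by auto
        then have "K * dist (f t) (f t') powr \<alpha> \<le> K * ?d powr \<alpha>"
          using assms by (intro mult_left_mono powr_mono2) auto
        then show "t' \<in> W" unfolding W_def using hol[of t t'] t t' by auto
      qed
      have "emeasure lebesgue W = ennreal (V * (?d powr \<alpha>) ^ DIM('a))"
        unfolding W_def V_def using assms by (simp add: emeasure_cball power_mult_distrib mult_ac)
      also have "\<dots> = ennreal V * ennreal ((?d powr \<alpha>) ^ DIM('a))"
        using V0 by (simp add: ennreal_mult)
      also have "\<dots> \<le> ennreal V * diam_pow s (U i)"
      proof (rule mult_left_mono)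
        have eq: "(?d powr \<alpha>) ^ DIM('a) = ?d powr (\<alpha> * DIM('a))"
          by (cases "?d = 0") (auto simp: powr_powr[symmetric] powr_realpow)
        have "?d powr (\<alpha> * DIM('a)) \<le> ?d powr s"
          using d s by (intro powr_mono') auto
        \<comment> \<open>This bound serves \<open>s = 0\<close>, where \<open>diam_pow\<close> of a
          nonempty set is 1 whatever its diameter.\<close>
        moreover have "?d powr (\<alpha> * DIM('a)) \<le> 1"
          using d assms powr_mono2[of "\<alpha> * DIM('a)" ?d 1] by auto
        ultimately show "ennreal ((?d powr \<alpha>) ^ DIM('a)) \<le> diam_pow s (U i)"
          unfolding diam_pow_def eq using t by (auto intro: ennreal_leI)
      qed auto
      finally show ?thesis using sub by (intro exI[of _ W]) (auto simp: W_def)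
    qed
    then obtain W where W: "\<And>i. T \<inter> f -` U i \<subseteq> W i" "\<And>i. W i \<in> sets lebesgue"
      "\<And>i. emeasure lebesgue (W i) \<le> ennreal V * diam_pow s (U i)" by metis
    have "emeasure lebesgue (\<Union>i. W i) \<le> (\<Sum>i. emeasure lebesgue (W i))"
      by (rule emeasure_subadditive_countably) (use W in auto)
    also have "\<dots> \<le> (\<Sum>i. ennreal V * diam_pow s (U i))"
      by (intro suminf_le W) auto
    also have "\<dots> = ennreal V * (\<Sum>i. diam_pow s (U i))" by simp
    also have "\<dots> \<le> ennreal V * ennreal e'"
      using U(4) by (intro mult_left_mono) auto
    also have "\<dots> \<le> ennreal e"
      using V0 e' by (simp add: ennreal_mult[symmetric] ennreal_leI)
    finally have le: "emeasure lebesgue (\<Union>i. W i) \<le> ennreal e" .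
    show "\<exists>W. T \<subseteq> W \<and> W \<in> lmeasurable \<and> measure lebesgue W \<le> e"
    proof (intro exI conjI)
      show "T \<subseteq> (\<Union>i. W i)" using U(1) W(1) by blast
      show "(\<Union>i. W i) \<in> lmeasurable"
        using W(2) le by (intro fmeasurableI) (auto simp: top_unique less_top[symmetric])
      show "measure lebesgue (\<Union>i. W i) \<le> e"
        using le e by (simp add: measure_def enn2real_leI)
    qed
  qed
  with T show False by simp
qed

text \<open>Infinitely many disjoint translates of \<open>S\<close> fit into a bounded set.\<close>

lemma negligible_if_transversal:
  fixes S :: "'a::euclidean_space set"
  assumes S: "S \<in> sets lebesgue" "bounded S"
    and v: "\<And>x r. x \<in> S \<Longrightarrow> x + r *\<^sub>R v \<in> S \<Longrightarrow> r = 0"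
  shows "negligible S"
proof -
  have lm: "S \<in> lmeasurable" using S by (simp add: bounded_set_imp_lmeasurable)
  obtain B where B: "\<And>x. x \<in> S \<Longrightarrow> norm x \<le> B" using S(2) unfolding bounded_iff by auto
  define C where "C = cball (0::'a) (B + norm v)"
  \<comment> \<open>The factors \<open>1 / real (Suc k)\<close> are pairwise distinct, which makes
    the translates disjoint, and at most 1, which keeps them all in \<open>C\<close>.\<close>
  define Y where "Y k = (+) ((1 / real (Suc k)) *\<^sub>R v) ` S" for k
  have Ylm: "Y k \<in> lmeasurable" "measure lebesgue (Y k) = measure lebesgue S" for k
    unfolding Y_def using lm by (auto simp: measurable_translation measure_translation)
  have disj: "disjoint_family Y"
    unfolding disjoint_family_on_def
  proof (intro ballI impI)
    fix k l :: nat assume "k \<noteq> l"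
    show "Y k \<inter> Y l = {}"
    proof (rule ccontr)
      assume "Y k \<inter> Y l \<noteq> {}"
      then obtain x y where xy: "x \<in> S" "y \<in> S"
        "(1 / real (Suc k)) *\<^sub>R v + x = (1 / real (Suc l)) *\<^sub>R v + y" unfolding Y_def by auto
      then have "y = x + (1 / real (Suc k) - 1 / real (Suc l)) *\<^sub>R v"
        by (simp add: algebra_simps)
      with v[of x] xy have "1 / real (Suc k) - 1 / real (Suc l) = 0" by metis
      then have "real (Suc k) = real (Suc l)" by (simp only: right_minus_eq divide_cancel_left) simp
      with \<open>k \<noteq> l\<close> show False by simp
    qed
  qed
  have sub: "Y k \<subseteq> C" for k
  proof
    fix y assume "y \<in> Y k"
    then obtain x where x: "x \<in> S" "y = (1 / real (Suc k)) *\<^sub>R v + x" unfolding Y_def by auto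
    have "norm y \<le> norm ((1 / real (Suc k)) *\<^sub>R v) + norm x" unfolding x by (rule norm_triangle_ineq)
    also have "norm ((1 / real (Suc k)) *\<^sub>R v) \<le> 1 * norm v"
      unfolding norm_scaleR by (intro mult_right_mono) auto
    finally show "y \<in> C" unfolding C_def using B[OF x(1)] by auto
  qed
  have bound: "real n * measure lebesgue S \<le> measure lebesgue C" for n
  proof -
    have "measure lebesgue (\<Union>k<n. Y k) = (\<Sum>k<n. measure lebesgue (Y k))"
    proof (rule measure_finite_Union)
      show "disjoint_family_on Y {..<n}" using disj by (rule disjoint_family_on_mono[rotated]) simp
      show "emeasure lebesgue (Y k) \<noteq> \<infinity>" for k using fmeasurableD2[OF Ylm(1)] by auto
    qed (use Ylm in \<open>auto dest: fmeasurableD\<close>)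
    moreover have "measure lebesgue (\<Union>k<n. Y k) \<le> measure lebesgue C"
      by (rule measure_mono_fmeasurable) (use sub Ylm in \<open>auto simp: C_def dest: fmeasurableD\<close>)
    ultimately show ?thesis using Ylm by simp
  qed
  have "measure lebesgue S = 0"
  proof (rule ccontr)
    assume "measure lebesgue S \<noteq> 0"
    then have pos: "measure lebesgue S > 0" by (simp add: zero_less_measure_iff)
    obtain n where "measure lebesgue C < real n * measure lebesgue S"
      using reals_Archimedean3[OF pos] by blast
    with bound[of n] show False by simp
  qed
  then show ?thesis using lm by (simp add: negligible_iff_measure)
qed

section \<open>Digit expansions\<close>

text \<open>Position \<open>k\<close> carries weight \<open>1 / b ^ (k + 1)\<close>. Reducing the
  floor modulo \<open>b\<close> gives the digits of the fractional part, also for negative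
  \<open>t\<close>.\<close>

definition digit :: "nat \<Rightarrow> real \<Rightarrow> nat \<Rightarrow> int" where
  "digit b t k = \<lfloor>real b ^ Suc k * t\<rfloor> mod int b"

text \<open>The integer that the first \<open>n\<close> digits spell in base \<open>b\<close>,
  leading digit first.\<close>

primrec horner :: "nat \<Rightarrow> (nat \<Rightarrow> int) \<Rightarrow> nat \<Rightarrow> int" where
  "horner b d 0 = 0"
| "horner b d (Suc n) = int b * horner b d n + d n"

definition expansion :: "nat \<Rightarrow> (nat \<Rightarrow> int) \<Rightarrow> real" where
  "expansion b d = (\<Sum>n. real_of_int (d n) / real b ^ Suc n)"

context
  fixes b :: nat
  assumes b: "b \<ge> 2"
begin

lemma digit_bounds: "0 \<le> digit b t k" "digit b t k < int b"
  using b by (auto simp: digit_def)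

lemma floor_power_Suc: "\<lfloor>real b ^ Suc k * t\<rfloor> = int b * \<lfloor>real b ^ k * t\<rfloor> + digit b t k"
proof -
  have "\<lfloor>real b ^ k * t\<rfloor> = \<lfloor>(real b ^ Suc k * t) / real_of_int (int b)\<rfloor>"
    using b by (simp add: field_simps)
  also have "\<dots> = \<lfloor>real b ^ Suc k * t\<rfloor> div int b"
    by (rule floor_divide_real_eq_div) simp
  finally show ?thesis unfolding digit_def by simp
qed

lemma horner_digit: "horner b (digit b t) n = \<lfloor>real b ^ n * t\<rfloor> - int b ^ n * \<lfloor>t\<rfloor>"
proof (induction n)
  case (Suc n)
  show ?case unfolding horner.simps Suc floor_power_Suc by (simp add: algebra_simps)
qed simp

lemma horner_add: "horner b d (n + l) = int b ^ l * horner b d n + horner b (\<lambda>j. d (n + j)) l"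
  by (induction l) (auto simp: algebra_simps)

lemma horner_cong: "(\<And>j. j < n \<Longrightarrow> d j = d' j) \<Longrightarrow> horner b d n = horner b d' n"
  by (induction n) auto

lemma sum_digits: "(\<Sum>j<n. real_of_int (d j) / real b ^ Suc j) = horner b d n / real b ^ n"
  using b by (induction n) (auto simp: field_simps)

lemma geometric_sums: "(\<lambda>n. (real b - 1) / real b ^ Suc n) sums 1"
proof -
  \<comment> \<open>The rule cited is the library's geometric series; its name denotes the present
    lemma only after this proof.\<close>
  have "(\<lambda>n. (1 / real b) ^ n) sums (1 / (1 - 1 / real b))"
    by (rule geometric_sums) (use b in auto)
  from sums_mult[OF this, of "(real b - 1) / real b"]
  have "(\<lambda>n. (real b - 1) / real b * (1 / real b) ^ n) sums ((real b - 1) / real b * (1 / (1 - 1 / real b)))" .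
  moreover have "(real b - 1) / real b * (1 / (1 - 1 / real b)) = 1" using b by (simp add: field_simps)
  moreover have "(real b - 1) / real b * (1 / real b) ^ n = (real b - 1) / real b ^ Suc n" for n
    by (simp add: field_simps)
  ultimately show ?thesis by (simp only:)
qed

lemma summable_digits:
  assumes "\<And>n. 0 \<le> d n" "\<And>n. d n < int b"
  shows "summable (\<lambda>n. real_of_int (d n) / real b ^ Suc n)"
proof (rule summable_comparison_test)
  show "summable (\<lambda>n. (real b - 1) / real b ^ Suc n)" using geometric_sums by (rule sums_summable)
  have "norm (real_of_int (d n) / real b ^ Suc n) \<le> (real b - 1) / real b ^ Suc n" for n
  proof -
    have "0 \<le> real_of_int (d n)" "real_of_int (d n) \<le> real b - 1"
      using assms[of n] by linarith+
    then show ?thesis by (simp add: divide_right_mono)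
  qed
  then show "\<exists>N. \<forall>n\<ge>N. norm (real_of_int (d n) / real b ^ Suc n) \<le> (real b - 1) / real b ^ Suc n" by blast
qed

lemma expansion_bounds_01:
  assumes "\<And>n. 0 \<le> d n" "\<And>n. d n < int b"
  shows "0 \<le> expansion b d" "expansion b d \<le> 1"
proof -
  show "0 \<le> expansion b d" unfolding expansion_def
    by (rule suminf_nonneg[OF summable_digits]) (use assms in auto)
  have "real_of_int (d n) / real b ^ Suc n \<le> (real b - 1) / real b ^ Suc n" for n
  proof -
    have "real_of_int (d n) \<le> real b - 1" using assms[of n] by linarith
    then show ?thesis by (rule divide_right_mono) simp
  qed
  then have "expansion b d \<le> (\<Sum>n. (real b - 1) / real b ^ Suc n)"
    unfolding expansion_def
    by (intro suminf_le summable_digits sums_summable[OF geometric_sums]) (use assms in auto)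
  then show "expansion b d \<le> 1" using sums_unique[OF geometric_sums] by simp
qed

lemma expansion_split:
  assumes "\<And>n. 0 \<le> d n" "\<And>n. d n < int b"
  shows "real b ^ n * expansion b d = horner b d n + expansion b (\<lambda>j. d (n + j))"
proof -
  let ?f = "\<lambda>n. real_of_int (d n) / real b ^ Suc n"
  have "expansion b d = (\<Sum>j. ?f (j + n)) + (\<Sum>j<n. ?f j)"
    unfolding expansion_def by (rule suminf_split_initial_segment[OF summable_digits]) (use assms in auto)
  moreover have "(\<Sum>j. real b ^ n * ?f (j + n)) = real b ^ n * (\<Sum>j. ?f (j + n))"
    by (rule suminf_mult, subst summable_iff_shift[of ?f], rule summable_digits)
      (use assms in auto)
  moreover have "(\<lambda>j. real b ^ n * ?f (j + n)) = (\<lambda>j. real_of_int (d (n + j)) / real b ^ Suc j)"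
    using b by (simp add: fun_eq_iff power_add add.commute)
  ultimately show ?thesis
    unfolding sum_digits expansion_def[of b "\<lambda>j. d (n + j)"] using b by (simp add: distrib_left)
qed

text \<open>The upper bound is not strict because a tail consisting of digits \<open>b - 1\<close>
  adds up to a full unit.\<close>

lemma expansion_bounds:
  assumes "\<And>n. 0 \<le> d n" "\<And>n. d n < int b"
  shows "horner b d n \<le> real b ^ n * expansion b d" "real b ^ n * expansion b d \<le> horner b d n + 1"
  using expansion_split[OF assms, of n] expansion_bounds_01[of "\<lambda>j. d (n + j)"] assms by auto

text \<open>Agreement with the digits of \<theta> puts both \<open>b ^ l * \<theta>\<close> and
  \<open>b ^ l\<close> times its approximation into the closed unit interval starting at
  \<open>\<lfloor>real b ^ l * \<theta>\<rfloor>\<close>. Subtracting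
  \<open>\<lfloor>\<theta>\<rfloor>\<close> in the integer restores the part of \<theta> that its
  digits ignore.\<close>

lemma expansion_block_approx:
  assumes "\<And>n. 0 \<le> d n" "\<And>n. d n < int b"
    and "\<And>j. j < l \<Longrightarrow> d (n + j) = digit b \<theta> j"
  shows "\<bar>real b ^ n * expansion b d - real_of_int (horner b d n - \<lfloor>\<theta>\<rfloor>) - \<theta>\<bar> \<le> 1 / real b ^ l"
proof -
  have "horner b (\<lambda>j. d (n + j)) l = horner b (digit b \<theta>) l"
    using assms(3) by (rule horner_cong)
  then have "horner b d (n + l) = int b ^ l * (horner b d n - \<lfloor>\<theta>\<rfloor>) + \<lfloor>real b ^ l * \<theta>\<rfloor>"
    unfolding horner_add by (simp add: horner_digit algebra_simps)
  then have h: "real_of_int (horner b d (n + l))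
      = real b ^ l * real_of_int (horner b d n - \<lfloor>\<theta>\<rfloor>) + \<lfloor>real b ^ l * \<theta>\<rfloor>"
    by simp
  define z where "z = real b ^ n * expansion b d - real_of_int (horner b d n - \<lfloor>\<theta>\<rfloor>)"
  have "real b ^ (n + l) * expansion b d = real b ^ l * (z + real_of_int (horner b d n - \<lfloor>\<theta>\<rfloor>))"
    unfolding z_def by (simp add: power_add)
  moreover have "horner b d (n + l) \<le> real b ^ (n + l) * expansion b d"
    "real b ^ (n + l) * expansion b d \<le> horner b d (n + l) + 1"
    using assms by (intro expansion_bounds; simp)+
  ultimately have "\<lfloor>real b ^ l * \<theta>\<rfloor> \<le> real b ^ l * z" "real b ^ l * z \<le> \<lfloor>real b ^ l * \<theta>\<rfloor> + 1"
    using h by (simp_all add: distrib_left)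
  then have "\<bar>real b ^ l * z - real b ^ l * \<theta>\<bar> \<le> 1" by linarith
  then have "real b ^ l * \<bar>z - \<theta>\<bar> \<le> 1"
    unfolding right_diff_distrib[symmetric] abs_mult by simp
  then show ?thesis unfolding z_def[symmetric] using b by (simp add: field_simps)
qed

end

section \<open>Splicing the digits of a parameter into the free positions\<close>

definition free_count :: "(nat \<Rightarrow> bool) \<Rightarrow> nat \<Rightarrow> nat" where
  "free_count P n = card {j. j < n \<and> P j}"

lemma free_count_0: "free_count P 0 = 0"
  by (simp add: free_count_def)

lemma free_count_Suc: "free_count P (Suc n) = (if P n then Suc (free_count P n) else free_count P n)"
proof -
  have "{j. j < Suc n \<and> P j} = (if P n then insert n {j. j < n \<and> P j} else {j. j < n \<and> P j})"
    by (auto simp: less_Suc_eq)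
  then show ?thesis by (simp add: free_count_def)
qed

definition splice_digits :: "nat \<Rightarrow> (nat \<Rightarrow> bool) \<Rightarrow> (nat \<Rightarrow> int) \<Rightarrow> real \<Rightarrow> nat \<Rightarrow> int" where
  "splice_digits b P e t n = (if P n then digit b t (free_count P n) else e n)"

context
  fixes b :: nat and P :: "nat \<Rightarrow> bool" and e :: "nat \<Rightarrow> int"
  assumes b: "b \<ge> 2" and e: "\<And>n. 0 \<le> e n" "\<And>n. e n < int b"
begin

lemma splice_digits_bounds: "0 \<le> splice_digits b P e t n" "splice_digits b P e t n < int b"
  using e digit_bounds[OF b] by (auto simp: splice_digits_def)

text \<open>The digit prefix of the image separates points at least as well as the prefix of \<open>t\<close>
  that has been copied into it; no uniqueness of expansions is involved.\<close>

lemma horner_splice_ge: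
  assumes "0 \<le> t" "t \<le> t'" "t' < 1"
  shows "\<lfloor>real b ^ free_count P n * t'\<rfloor> - \<lfloor>real b ^ free_count P n * t\<rfloor>
    \<le> horner b (splice_digits b P e t') n - horner b (splice_digits b P e t) n"
proof (induction n)
  case 0
  have "\<lfloor>t\<rfloor> = 0" "\<lfloor>t'\<rfloor> = 0" using assms by linarith+
  then show ?case by (simp add: free_count_0)
next
  case (Suc n)
  let ?T = "\<lambda>t. \<lfloor>real b ^ free_count P n * t\<rfloor>"
  let ?A = "\<lambda>t. horner b (splice_digits b P e t) n"
  have "?T t \<le> ?T t'" using assms by (intro floor_mono mult_left_mono) auto
  \<comment> \<open>At a position that is not free, the left side stays and the right side is
    multiplied by \<open>b\<close>; this preserves the inequality because the right side is
    nonnegative.\<close>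
  then have mono: "0 \<le> ?A t' - ?A t" using Suc by linarith
  have "int b * (?T t' - ?T t) \<le> int b * (?A t' - ?A t)" by (intro mult_left_mono Suc) simp
  moreover have "1 * (?A t' - ?A t) \<le> int b * (?A t' - ?A t)"
    using mono b by (intro mult_right_mono) auto
  moreover have "splice_digits b P e t n = (if P n then digit b t (free_count P n) else e n)" for t
    by (simp add: splice_digits_def)
  ultimately show ?case
    using Suc floor_power_Suc[OF b, of "free_count P n" t] floor_power_Suc[OF b, of "free_count P n" t']
    by (simp add: free_count_Suc right_diff_distrib del: power_Suc)
qed

text \<open>The loss of 2 pays once for the floors and once for the digit tails beyond position
  \<open>n\<close>.\<close>

lemma expansion_splice_diff_ge:
  assumes "0 \<le> t" "t \<le> t'" "t' < 1"
  shows "real b ^ free_count P n * (t' - t) - 2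
    \<le> real b ^ n * (expansion b (splice_digits b P e t') - expansion b (splice_digits b P e t))"
proof -
  have "real_of_int (\<lfloor>real b ^ free_count P n * t'\<rfloor> - \<lfloor>real b ^ free_count P n * t\<rfloor>)
    \<le> horner b (splice_digits b P e t') n - horner b (splice_digits b P e t) n"
    using horner_splice_ge[OF assms] by (simp only: of_int_le_iff)
  moreover have "horner b (splice_digits b P e t) n \<le> real b ^ n * expansion b (splice_digits b P e t)"
    "real b ^ n * expansion b (splice_digits b P e t) \<le> horner b (splice_digits b P e t) n + 1" for t
    by (intro expansion_bounds b splice_digits_bounds)+
  note this[of t] this[of t']
  ultimately show ?thesis unfolding right_diff_distrib by linarith
qed

text \<open>Images within \<open>1 / real b ^ n\<close> of each other force
  \<open>real b ^ free_count P n * (t' - t) \<le> 3\<close>, and \<open>F\<close> makes the exponent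
  at least \<open>\<sigma> * n - C\<close>. The best \<open>n\<close> for a given distance of the
  images turns this into a power of that distance.\<close>

lemma expansion_splice_inverse_hoelder:
  assumes \<sigma>: "\<sigma> > 0" and F: "\<And>n. \<sigma> * real n - C \<le> free_count P n"
    and t: "0 \<le> t" "t < 1" "0 \<le> t'" "t' < 1"
  shows "\<bar>t - t'\<bar> \<le> 3 * real b powr (C + \<sigma>) *
    \<bar>expansion b (splice_digits b P e t) - expansion b (splice_digits b P e t')\<bar> powr \<sigma>"
  using t
proof (induction t t' rule: linorder_wlog)
  case (sym t t')
  then show ?case by (simp add: abs_minus_commute)
next
  case (le t t')
  define \<phi> where "\<phi> = (\<lambda>t. expansion b (splice_digits b P e t))"
  define d where "d = \<bar>\<phi> t - \<phi> t'\<bar>"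
  have b0: "real b > 1" "real b > 0" using b by auto
  have small: "t' - t \<le> 3 * real b powr (C - \<sigma> * n)" if "d \<le> 1 / real b ^ n" for n
  proof -
    have "real b ^ n * (\<phi> t' - \<phi> t) \<le> real b ^ n * (1 / real b ^ n)"
      using that by (intro mult_left_mono) (auto simp: d_def)
    then have "real b ^ free_count P n * (t' - t) \<le> 3"
      using expansion_splice_diff_ge[of t t' n] le b0 by (simp add: \<phi>_def)
    then have "t' - t \<le> 3 / real b ^ free_count P n" using b0 by (simp add: field_simps)
    also have "\<dots> = 3 * real b powr (- real (free_count P n))"
      using b0 by (simp add: powr_minus powr_realpow field_simps)
    also have "\<dots> \<le> 3 * real b powr (C - \<sigma> * n)"
      using F[of n] b0 by (intro mult_left_mono powr_mono) auto
    finally show ?thesis .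
  qed
  have d01: "0 \<le> d" "d \<le> 1"
  proof -
    have "0 \<le> \<phi> t" "\<phi> t \<le> 1" for t
      unfolding \<phi>_def by (intro expansion_bounds_01 b splice_digits_bounds)+
    from this[of t] this[of t'] show "0 \<le> d" "d \<le> 1" by (auto simp: d_def)
  qed
  have "t' - t \<le> 3 * real b powr (C + \<sigma>) * d powr \<sigma>"
  proof (cases "d = 0")
    case True
    \<comment> \<open>With \<open>d = 0\<close> every \<open>n\<close> is admissible, and letting
      \<open>n\<close> grow forces \<open>t' - t \<le> 0\<close>.\<close>
    have "real b powr - \<sigma> < 1" using powr_less_mono[of "- \<sigma>" 0 "real b"] b0 \<sigma> by simp
    then have "(\<lambda>n. 3 * real b powr C * (real b powr (-\<sigma>)) ^ n) \<longlonglongrightarrow> 3 * real b powr C * 0"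
      by (intro tendsto_mult tendsto_const LIMSEQ_power_zero) simp
    moreover have "t' - t \<le> 3 * real b powr C * (real b powr (-\<sigma>)) ^ n" for n
      using small[of n] True b0 by (simp add: powr_diff powr_minus powr_power field_simps)
    ultimately have "t' - t \<le> 3 * real b powr C * 0"
      by (intro LIMSEQ_le_const) auto
    then show ?thesis using True by simp
  next
    case False
    then have dpos: "d > 0" using d01 by simp
    \<comment> \<open>The largest \<open>n\<close> with \<open>d \<le> 1 / real b ^ n\<close>.
      Rounding costs less than one position, hence the factor \<open>real b powr \<sigma>\<close> in
      the constant.\<close>
    define n where "n = nat \<lfloor>log b (1 / d)\<rfloor>"
    have lg: "0 \<le> log b (1 / d)" using d01 dpos b0 by (simp add: log_divide)
    then have n: "real n \<le> log b (1 / d)" "log b (1 / d) < real n + 1" unfolding n_def by linarith+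
    have "real b ^ n \<le> 1 / d"
      using n(1) b0 dpos by (simp add: powr_realpow[symmetric] le_log_iff)
    then have "d \<le> 1 / real b ^ n" using dpos b0 by (simp add: field_simps)
    then have "t' - t \<le> 3 * real b powr (C - \<sigma> * n)" by (rule small)
    also have "\<dots> \<le> 3 * real b powr (C + \<sigma> + \<sigma> * log b d)"
    proof -
      have "- log b d < real n + 1" using n(2) dpos b0 by (simp add: log_divide)
      then have "\<sigma> * (- log b d) \<le> \<sigma> * (real n + 1)" using \<sigma> by (intro mult_left_mono) auto
      then have "C - \<sigma> * n \<le> C + \<sigma> + \<sigma> * log b d" by (simp add: algebra_simps)
      then show ?thesis using b0 by (intro mult_left_mono powr_mono) auto
    qed
    also have "\<dots> = 3 * real b powr (C + \<sigma>) * (real b powr log b d) powr \<sigma>"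
      by (simp add: powr_add powr_powr mult_ac)
    also have "real b powr log b d = d" using b0 dpos by simp
    finally show ?thesis .
  qed
  then show ?case using le by (simp add: d_def \<phi>_def)
qed

lemma borel_measurable_digit [measurable]: "(\<lambda>t. real_of_int (digit b t k)) \<in> borel_measurable borel"
  unfolding digit_def by measurable

lemma borel_measurable_expansion_splice [measurable]:
  "(\<lambda>t. expansion b (splice_digits b P e t)) \<in> borel_measurable borel"
proof -
  have "(\<lambda>t. real_of_int (splice_digits b P e t n) / real b ^ Suc n) \<in> borel_measurable borel" for n
    by (cases "P n") (auto simp: splice_digits_def)
  then show ?thesis unfolding expansion_def by (rule borel_measurable_suminf)
qed

end

section \<open>The density of the free positions\<close>

text \<open>A position below \<open>n'\<close> that is not free lies in a block starting before
  \<open>N k\<close>, hence in one of index less than \<open>k\<close>. The separate cutoff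
  \<open>n'\<close> permits counting only up to \<open>N k\<close> when \<open>n\<close> lies inside
  block \<open>k\<close>.\<close>

lemma free_count_ge:
  assumes mono: "\<And>k. N k + L k \<le> N (Suc k)"
    and n: "n' \<le> n" "n' \<le> N k"
  shows "int n' - (\<Sum>j<k. int (L j)) \<le> free_count (\<lambda>n. \<forall>k. \<not> (N k \<le> n \<and> n < N k + L k)) n"
    (is "_ \<le> int (free_count ?P n)")
proof -
  have inc: "mono N"
    unfolding mono_iff_le_Suc using mono by (metis add_leE)
  have "{..<n'} \<subseteq> {j. j < n \<and> ?P j} \<union> (\<Union>j<k. {N j..<N j + L j})"
  proof
    fix x assume x: "x \<in> {..<n'}"
    show "x \<in> {j. j < n \<and> ?P j} \<union> (\<Union>j<k. {N j..<N j + L j})"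
    proof (cases "?P x")
      case False
      then obtain l where l: "N l \<le> x" "x < N l + L l" by auto
      have "l < k"
      proof (rule ccontr)
        assume "\<not> l < k"
        then have "N k \<le> N l" using inc by (simp add: monoD)
        with l x n show False by simp
      qed
      with l show ?thesis by auto
    qed (use x n in auto)
  qed
  then have "card {..<n'} \<le> card ({j. j < n \<and> ?P j} \<union> (\<Union>j<k. {N j..<N j + L j}))"
    by (intro card_mono) auto
  also have "\<dots> \<le> card {j. j < n \<and> ?P j} + card (\<Union>j<k. {N j..<N j + L j})"
    by (rule card_Un_le)
  also have "card (\<Union>j<k. {N j..<N j + L j}) \<le> (\<Sum>j<k. card {N j..<N j + L j})"
    by (rule card_UN_le) simp
  finally have "n' \<le> free_count ?P n + (\<Sum>j<k. L j)" by (simp add: free_count_def)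
  then have "int n' \<le> int (free_count ?P n + (\<Sum>j<k. L j))" by (simp only: of_nat_le_iff)
  then show ?thesis by simp
qed

text \<open>The growth rate \<open>2 / (1 - w)\<close> maximises the lower density of the free positions.\<close>

definition growth :: "real \<Rightarrow> real" where
  "growth w = 2 / (1 - w)"

text \<open>The offset in the exponent makes the powers large enough to absorb the rounding errors
  from the first block on.\<close>

definition block_start :: "real \<Rightarrow> nat \<Rightarrow> nat" where
  "block_start w k = nat \<lceil>growth w ^ (k + 2)\<rceil>"

text \<open>The ceiling is \<open>w\<close> times the next block start, up to rounding. The
  \<open>k\<close> further digits improve the approximation by \<open>b ^ k\<close>, which
  eventually beats every constant \<open>c\<close> and the constant of the norm.\<close>

definition block_length :: "real \<Rightarrow> nat \<Rightarrow> nat" where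
  "block_length w k = nat \<lceil>w * growth w ^ (k + 3)\<rceil> + k"

definition free_pos :: "real \<Rightarrow> nat \<Rightarrow> bool" where
  "free_pos w n \<longleftrightarrow> (\<forall>k. \<not> (block_start w k \<le> n \<and> n < block_start w k + block_length w k))"

context
  fixes w :: real
  assumes w: "0 \<le> w" "w < 1"
begin

lemma growth_ge_2: "2 \<le> growth w"
  using w by (simp add: growth_def field_simps)

lemma block_start_bounds:
  "growth w ^ (k + 2) \<le> block_start w k" "block_start w k \<le> growth w ^ (k + 2) + 1"
proof -
  have "0 \<le> growth w ^ (k + 2)" using growth_ge_2 by simp
  then show "growth w ^ (k + 2) \<le> block_start w k" "block_start w k \<le> growth w ^ (k + 2) + 1"
    unfolding block_start_def by linarith+
qed

lemma block_length_bounds: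
  "w * growth w ^ (k + 3) + k \<le> block_length w k" "block_length w k \<le> w * growth w ^ (k + 3) + k + 1"
proof -
  have "0 \<le> w * growth w ^ (k + 3)" using growth_ge_2 w by simp
  then show "w * growth w ^ (k + 3) + k \<le> block_length w k" "block_length w k \<le> w * growth w ^ (k + 3) + k + 1"
    unfolding block_length_def by linarith+
qed

lemma power_growth_ge: "2 ^ n \<le> growth w ^ n"
  using growth_ge_2 by (intro power_mono) auto

text \<open>Up to lower order terms, block \<open>k\<close> thus ends at \<open>growth w - 1\<close>
  times its start and leaves a free gap as long as \<open>block_start w k\<close>.\<close>

lemma growth_mult: "w * growth w = growth w - 2"
  using w by (simp add: growth_def field_simps)

text \<open>By \<open>growth_mult\<close> the leading terms leave a gap of
  \<open>growth w ^ (k + 2)\<close>, which is at least \<open>k + 2\<close>, the bound for rounding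
  errors and extra digits.\<close>

lemma block_step: "block_start w k + block_length w k \<le> block_start w (Suc k)"
proof -
  let ?P = "growth w ^ (k + 2)"
  have "k + 2 \<le> (2::nat) ^ (k + 1)" using less_exp[of "k + 1"] by linarith
  then have "real (k + 2) \<le> real (2 ^ (k + 1))" by (simp only: of_nat_le_iff)
  also have "\<dots> \<le> 2 ^ (k + 2)" by simp
  also have "\<dots> \<le> ?P" by (rule power_growth_ge)
  finally have kP: "real k + 2 \<le> ?P" by simp
  have "w * growth w ^ (k + 3) = (w * growth w) * ?P" by (simp add: power_add eval_nat_numeral)
  also have "\<dots> = growth w ^ (k + 3) - 2 * ?P"
    unfolding growth_mult by (simp add: algebra_simps power_add eval_nat_numeral)
  finally have "real (block_start w k) + real (block_length w k) \<le> growth w ^ (k + 3)"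
    using block_start_bounds(2)[of k] block_length_bounds(2)[of k] kP by linarith
  also have "\<dots> \<le> real (block_start w (Suc k))"
    using block_start_bounds(1)[of "Suc k"] by (simp add: eval_nat_numeral)
  finally show ?thesis by linarith
qed

lemma block_start_less_Suc: "block_start w k < block_start w (Suc k)"
proof -
  have "growth w ^ (k + 2) + 1 < growth w ^ (Suc k + 2)"
  proof -
    have "4 \<le> growth w ^ (k + 2)"
      using power_increasing[of 2 "k + 2" "2::real"] by (intro order_trans[OF _ power_growth_ge]) simp
    moreover have "2 * growth w ^ (k + 2) \<le> growth w * growth w ^ (k + 2)"
      using growth_ge_2 by (intro mult_right_mono) auto
    ultimately show ?thesis by (simp only: add_Suc power_Suc)
  qed
  then show ?thesis using block_start_bounds(2)[of k] block_start_bounds(1)[of "Suc k"] by linarith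
qed

lemma strict_mono_block_start: "strict_mono (block_start w)"
  using block_start_less_Suc by (rule strict_mono_Suc_iff[THEN iffD2, rule_format])

lemma block_cases:
  assumes "block_start w 0 \<le> n"
  obtains k where "block_start w k \<le> n" "n < block_start w (Suc k)"
proof -
  let ?K = "{k. block_start w k \<le> n}"
  have fin: "finite ?K"
    by (rule finite_subset[of _ "{..n}"]) (use strict_mono_imp_increasing[OF strict_mono_block_start] in \<open>auto intro: le_trans\<close>)
  have "block_start w (Max ?K) \<le> n" using Max_in[OF fin] assms by auto
  moreover have "n < block_start w (Suc (Max ?K))" using Max_ge[OF fin, of "Suc (Max ?K)"] by force
  ultimately show ?thesis by (rule that)
qed

text \<open>A geometric sum: its last term is multiplied by at most
  \<open>growth w / (growth w - 1) = 2 / (1 + w)\<close>. The errors \<open>j + 1\<close> of the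
  single lengths add up to at most the square of \<open>k\<close>.\<close>

lemma sum_block_length_le:
  "(\<Sum>j<k. real (block_length w j)) \<le> 2 * w / (1 + w) * growth w ^ (k + 2) + real k ^ 2"
proof (induction k)
  case (Suc k)
  let ?P = "growth w ^ (k + 2)"
  have w': "1 + w > 0" "1 - w > 0" using w by auto
  have eq: "growth w ^ (k + 3) = growth w * ?P" by (simp add: eval_nat_numeral)
  have "2 * w / (1 + w) * ?P + w * (growth w * ?P) = 2 * w / (1 + w) * (growth w * ?P)"
  proof -
    have "2 * w / (1 + w) + w * growth w = 2 * w / (1 + w) * growth w"
      using w' unfolding growth_def by (simp add: divide_simps) (simp add: algebra_simps)
    then have "(2 * w / (1 + w) + w * growth w) * ?P = 2 * w / (1 + w) * growth w * ?P" by simp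
    then show ?thesis by (simp only: algebra_simps)
  qed
  with Suc block_length_bounds(2)[of k]
  show ?case by (simp add: eq power2_eq_square algebra_simps)
qed (use w growth_ge_2 in simp)

text \<open>Put \<open>r = (1 - w) / (1 + w)\<close> and \<open>P = growth w ^ (k + 2)\<close>. The
  worst \<open>n\<close> is the end of block \<open>k\<close>: up to lower order terms,
  \<open>r * P\<close> of the \<open>P / r\<close> positions before it are free, a ratio of
  \<open>r * r\<close>. The polynomial in \<open>k\<close> collects rounding errors and extra
  digits.\<close>

lemma free_count_ge_aux:
  assumes n: "block_start w k \<le> n" "n \<le> block_start w (Suc k)"
  shows "((1 - w) / (1 + w))\<^sup>2 * n - (real k ^ 2 + k + 2) \<le> free_count (free_pos w) n"
proof -
  let ?P = "growth w ^ (k + 2)" and ?r = "(1 - w) / (1 + w)"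
  let ?N = "real (block_start w k)" and ?L = "real (block_length w k)" and ?S = "\<Sum>j<k. real (block_length w j)"
  have count: "real n' - (\<Sum>j<l. real (block_length w j)) \<le> free_count (free_pos w) n"
    if "n' \<le> n" "n' \<le> block_start w l" for n' l
  proof -
    have "int n' - (\<Sum>j<l. int (block_length w j)) \<le> int (free_count (free_pos w) n)"
      unfolding free_pos_def[abs_def] by (rule free_count_ge[OF block_step that])
    then have "real_of_int (int n' - (\<Sum>j<l. int (block_length w j))) \<le> real_of_int (int (free_count (free_pos w) n))"
      by (simp only: of_int_le_iff)
    then show ?thesis by simp
  qed
  have w': "1 + w > 0" "1 - w > 0" using w by auto
  have r: "0 \<le> ?r" "?r \<le> 1" using w by auto
  then have r2: "0 \<le> ?r\<^sup>2" "?r\<^sup>2 \<le> 1" by (auto simp: power_le_one)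
  have P: "0 \<le> ?P" using growth_ge_2 by simp
  have "?r * ?P = ?P - 2 * w / (1 + w) * ?P" using w' by (simp add: field_simps)
  moreover have le: "a = p - c \<Longrightarrow> p \<le> x \<Longrightarrow> s \<le> c + y \<Longrightarrow> a - y \<le> x - s" for a c p s x y :: real
    by linarith
  ultimately have NS: "?r * ?P - real k ^ 2 \<le> ?N - ?S"
    using le[OF _ block_start_bounds(1)[of k] sum_block_length_le[of k]] by simp
  have "?P + w * growth w ^ (k + 3) = (1 + w * growth w) * ?P"
    by (simp add: algebra_simps eval_nat_numeral)
  also have "1 + w * growth w = (1 + w) / (1 - w)"
    unfolding growth_def using w' by (simp add: field_simps)
  finally have "?N + ?L \<le> (1 + w) / (1 - w) * ?P + (real k + 2)"
    using block_start_bounds(2)[of k] block_length_bounds(2)[of k] by linarith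
  then have "?r\<^sup>2 * (?N + ?L) \<le> ?r\<^sup>2 * ((1 + w) / (1 - w) * ?P + (real k + 2))"
    using r2 by (intro mult_left_mono) auto
  also have "\<dots> = ?r * ?P + ?r\<^sup>2 * (real k + 2)"
  proof -
    have "?r\<^sup>2 * ((1 + w) / (1 - w)) = ?r" using w' by (simp add: power2_eq_square)
    then show ?thesis by (simp only: distrib_left mult.assoc[symmetric])
  qed
  also have "\<dots> \<le> ?r * ?P + (real k + 2)"
    using r2 by (intro add_left_mono mult_left_le_one_le) auto
  finally have "?r\<^sup>2 * (?N + ?L) \<le> ?r * ?P + (real k + 2)" .
  moreover have NL_aux: "x \<le> a + (y + 2) \<Longrightarrow> a - z \<le> d \<Longrightarrow> x - (z + y + 2) \<le> d" for a d x y z :: real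
    by linarith
  ultimately have NL: "?r\<^sup>2 * (?N + ?L) - (real k ^ 2 + k + 2) \<le> ?N - ?S"
    by (intro NL_aux[OF _ NS])
  show ?thesis
  proof (cases "real n \<le> ?N + ?L")
    case True
    then have "?r\<^sup>2 * n \<le> ?r\<^sup>2 * (?N + ?L)" using r2 by (intro mult_left_mono) auto
    then show ?thesis using NL count[OF n(1), of k] by auto
  next
    \<comment> \<open>Past the end of the block the lower bound for the count grows with slope 1,
      which is at least the claimed density.\<close>
    case False
    then have "?r\<^sup>2 * (n - (?N + ?L)) \<le> 1 * (n - (?N + ?L))" using r2 by (intro mult_right_mono) auto
    then have "?r\<^sup>2 * n \<le> ?r\<^sup>2 * (?N + ?L) + (n - (?N + ?L))" by (simp add: algebra_simps)
    then show ?thesis using NL count[OF order_refl n(2)] by simp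
  qed
qed

text \<open>The error is polynomial in \<open>k\<close>, whereas \<open>n\<close> is at least
  \<open>2 ^ k\<close>; so any loss \<epsilon> in the density absorbs it up to a constant.\<close>

lemma free_count_lower_density:
  assumes "\<sigma> < ((1 - w) / (1 + w))\<^sup>2" "0 \<le> \<sigma>"
  obtains C where "\<And>n. \<sigma> * real n - C \<le> free_count (free_pos w) n"
proof -
  define \<epsilon> where "\<epsilon> = ((1 - w) / (1 + w))\<^sup>2 - \<sigma>"
  have \<epsilon>: "\<epsilon> > 0" using assms by (simp add: \<epsilon>_def)
  have "\<forall>\<^sub>F k::nat in sequentially. real k ^ 2 + real k + 2 \<le> \<epsilon> * 2 ^ k"
    using \<epsilon> by real_asymp
  then obtain K where K: "\<And>k::nat. K \<le> k \<Longrightarrow> real k ^ 2 + real k + 2 \<le> \<epsilon> * 2 ^ k"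
    unfolding eventually_sequentially by blast
  define D where "D = real K ^ 2 + real K + 2"
  have D: "real k ^ 2 + k + 2 \<le> \<epsilon> * 2 ^ k + D" for k
  proof (cases "K \<le> k")
    case False
    then have "real k ^ 2 \<le> real K ^ 2" by (intro power_mono) auto
    moreover have "real k \<le> real K" using False by simp
    ultimately have "real k ^ 2 + k + 2 \<le> D" unfolding D_def by linarith
    moreover have "0 \<le> \<epsilon> * 2 ^ k" using \<epsilon> by simp
    ultimately show ?thesis by linarith
  next
    case True
    then have "real k ^ 2 + k + 2 \<le> \<epsilon> * 2 ^ k" by (rule K)
    moreover have "0 \<le> D" by (simp add: D_def)
    ultimately show ?thesis by linarith
  qed
  \<comment> \<open>The second entry covers the positions before the first block.\<close>
  define C where "C = max D (\<sigma> * block_start w 0)"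
  have "\<sigma> * real n - C \<le> free_count (free_pos w) n" for n
  proof (cases "block_start w 0 \<le> n")
    case True
    then obtain k where k: "block_start w k \<le> n" "n < block_start w (Suc k)" by (rule block_cases)
    have "2 ^ k \<le> (2::real) ^ (k + 2)" by (intro power_increasing) auto
    also have "\<dots> \<le> n" using power_growth_ge[of "k + 2"] block_start_bounds(1)[of k] k(1) by linarith
    finally have "\<epsilon> * 2 ^ k \<le> \<epsilon> * n" using \<epsilon> by simp
    then show ?thesis
      using free_count_ge_aux[of k n] k D[of k] by (simp add: \<epsilon>_def C_def left_diff_distrib)
  next
    case False
    then have "\<sigma> * n \<le> \<sigma> * block_start w 0" using assms by (intro mult_left_mono) auto
    then show ?thesis by (simp add: C_def)
  qed
  then show ?thesis by (rule that)
qed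

end

section \<open>Points of the singular set\<close>

text \<open>The value matters only inside blocks, where the \<open>THE\<close> is determined.
  Elsewhere it is still some digit, so the digit bounds hold at every position.\<close>

definition block_digits :: "nat \<Rightarrow> real \<Rightarrow> real \<Rightarrow> nat \<Rightarrow> int" where
  "block_digits b w \<theta> n =
    digit b \<theta> (n - block_start w (THE k. block_start w k \<le> n \<and> n < block_start w (Suc k)))"

definition block_point :: "nat \<Rightarrow> real \<Rightarrow> real \<Rightarrow> real \<Rightarrow> real" where
  "block_point b w \<theta> t = expansion b (splice_digits b (free_pos w) (block_digits b w \<theta>) t)"

section \<open>Domination of an arbitrary norm by the maximum norm\<close>

lemma is_norm_nonneg:
  assumes "is_norm \<nu>"
  shows "0 \<le> \<nu> x"
proof -
  have "\<nu> 0 \<le> \<nu> x + \<nu> (- 1 *\<^sub>R x)"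
    using assms unfolding is_norm_def by (metis add.right_inverse scaleR_minus1_left)
  moreover have "\<nu> (- 1 *\<^sub>R x) = \<nu> x" "\<nu> 0 = 0"
    using assms unfolding is_norm_def by (metis abs_minus abs_one mult_1, blast)
  ultimately show ?thesis by linarith
qed

text \<open>The triangle inequality along the standard basis. It lets the approximation be checked
  coordinate by coordinate, at the cost of a constant factor.\<close>

lemma is_norm_le_sum:
  fixes \<nu> :: "real ^ 'm \<Rightarrow> real"
  assumes \<nu>: "is_norm \<nu>" and v: "\<And>i. \<bar>v $ i\<bar> \<le> \<delta>"
  shows "\<nu> v \<le> \<delta> * (\<Sum>i\<in>UNIV. \<nu> (axis i 1))"
proof -
  have zero: "\<nu> 0 = 0" and add: "\<nu> (x + y) \<le> \<nu> x + \<nu> y" and scale: "\<nu> (a *\<^sub>R x) = \<bar>a\<bar> * \<nu> x" for x y a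
    using \<nu> by (auto simp: is_norm_def)
  have "\<nu> (sum f A) \<le> (\<Sum>i\<in>A. \<nu> (f i))" if "finite A" for f and A :: "'m set"
    using that
  proof (induction A rule: finite_induct)
    case (insert x A)
    then show ?case using add[of "f x" "sum f A"] by simp
  qed (simp add: zero)
  then have "\<nu> (\<Sum>i\<in>UNIV. v $ i *\<^sub>R axis i 1) \<le> (\<Sum>i\<in>UNIV. \<nu> (v $ i *\<^sub>R axis i 1))" by simp
  also have "(\<Sum>i\<in>UNIV. v $ i *\<^sub>R axis i 1) = v"
    using basis_expansion[of v] by (simp add: scalar_mult_eq_scaleR)
  also have "(\<Sum>i\<in>UNIV. \<nu> (v $ i *\<^sub>R axis i 1)) \<le> (\<Sum>i\<in>UNIV. \<delta> * \<nu> (axis i 1))"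
    unfolding scale using v is_norm_nonneg[OF \<nu>] by (intro sum_mono mult_right_mono) auto
  finally show ?thesis by (simp add: sum_distrib_left)
qed

section \<open>The digit map into the singular set\<close>

context
  fixes w :: real and b :: nat
  assumes w: "0 \<le> w" "w < 1" and b: "b \<ge> 2"
begin

lemma block_digits_bounds: "0 \<le> block_digits b w \<theta> n" "block_digits b w \<theta> n < int b"
  using digit_bounds[OF b] by (auto simp: block_digits_def)

lemma splice_digits_block:
  assumes "j < block_length w k"
  shows "splice_digits b (free_pos w) (block_digits b w \<theta>) t (block_start w k + j) = digit b \<theta> j"
proof -
  let ?n = "block_start w k + j"
  have n: "block_start w k \<le> ?n" "?n < block_start w (Suc k)"
    using assms block_step[OF w, of k] by auto
  have "(THE k. block_start w k \<le> ?n \<and> ?n < block_start w (Suc k)) = k"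
  proof (rule the_equality)
    fix l assume "block_start w l \<le> ?n \<and> ?n < block_start w (Suc l)"
    then have "block_start w l < block_start w (Suc k)" "block_start w k < block_start w (Suc l)"
      using n by linarith+
    then have "l < Suc k" "k < Suc l" using strict_mono_less[OF strict_mono_block_start[OF w]] by auto
    then show "l = k" by simp
  qed (use n in simp)
  moreover have "\<not> free_pos w ?n" unfolding free_pos_def using assms by (auto intro!: exI[of _ k])
  ultimately show ?thesis by (simp add: splice_digits_def block_digits_def)
qed

lemma block_point_approx:
  obtains p :: int where
    "\<bar>real b ^ block_start w k * block_point b w \<theta> t - real_of_int p - \<theta>\<bar> \<le> 1 / real b ^ block_length w k"
  unfolding block_point_def
  by (rule that[unfolded block_point_def], rule expansion_block_approx[OF b])
    (auto intro: splice_digits_bounds[OF b] block_digits_bounds splice_digits_block)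

text \<open>For \<open>Q\<close> between the powers of \<open>b\<close> at two consecutive block
  starts, the denominator is the power at the lower one. Its error is governed by the length of that
  block, which was chosen to suit \<open>Q\<close> up to the upper one.\<close>

lemma block_point_mem_singular_set_base:
  fixes \<nu> :: "real ^ 'm \<Rightarrow> real" and \<theta> t :: "real ^ 'm"
  assumes \<nu>: "is_norm \<nu>"
  shows "(\<chi> i. block_point b w (\<theta> $ i) (t $ i)) \<in> singular_set_base b \<nu> \<theta> w"
  unfolding singular_set_base_def singular_set_on_def mem_Collect_eq
proof (intro allI impI)
  fix c :: real assume c: "c > 0"
  let ?x = "\<chi> i. block_point b w (\<theta> $ i) (t $ i)"
  have b1: "real b > 1" "real b > 0" using b by auto
  define K where "K = (\<Sum>i\<in>UNIV. \<nu> (axis i 1 :: real ^ 'm))"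
  have K: "0 \<le> K" unfolding K_def using is_norm_nonneg[OF \<nu>] by (intro sum_nonneg) auto
  \<comment> \<open>From \<open>k0\<close> on the extra digits of a block absorb
    \<open>K / c\<close>; the further factor \<open>b\<close> pays for rounding up the next block
    start.\<close>
  obtain k0 where k0: "K * real b / c < real b ^ k0" using real_arch_pow[OF b1(1)] by blast
  show "\<exists>Q0. \<forall>Q\<ge>Q0. \<exists>q\<in>{int b ^ N |N. 1 \<le> N}. \<exists>p :: int ^ 'm. 1 \<le> q \<and> real_of_int q \<le> Q \<and>
    \<nu> (real_of_int q *\<^sub>R ?x - int_vec p - \<theta>) \<le> c * Q powr (- w)"
  proof (intro exI[of _ "real b ^ block_start w k0"] allI impI)
    fix Q assume Q: "real b ^ block_start w k0 \<le> Q"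
    have Q1: "Q \<ge> 1" using Q one_le_power[of "real b" "block_start w k0"] b1 by linarith
    define n where "n = nat \<lfloor>log b Q\<rfloor>"
    have lg: "0 \<le> log b Q" using Q1 b1 by simp
    then have n: "real n \<le> log b Q" "log b Q < real n + 1" unfolding n_def by linarith+
    have "block_start w k0 \<le> log b Q"
      using Q b1 Q1 by (simp add: powr_realpow[symmetric] le_log_iff)
    then have n0: "block_start w k0 \<le> n" using n(2) by linarith
    have "block_start w 0 \<le> block_start w k0"
      using strict_mono_block_start[OF w] by (simp add: strict_mono_less_eq)
    with n0 have "block_start w 0 \<le> n" by simp
    then obtain k where k: "block_start w k \<le> n" "n < block_start w (Suc k)" by (rule block_cases[OF w])
    have "block_start w k0 < block_start w (Suc k)" using n0 k by linarith
    then have k0k: "k0 \<le> k" using strict_mono_less[OF strict_mono_block_start[OF w]] by simp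
    let ?N = "block_start w k" and ?L = "block_length w k"
    have N1: "1 \<le> ?N"
      using block_start_bounds(1)[OF w, of k] power_growth_ge[OF w, of "k + 2"] one_le_power[of "2::real" "k + 2"]
      by linarith
    have "real ?N \<le> log b Q" using k n by linarith
    then have NQ: "real b ^ ?N \<le> Q" using b1 Q1 by (simp add: powr_realpow[symmetric] le_log_iff)
    have "\<exists>p. \<bar>real b ^ ?N * block_point b w (\<theta> $ i) (t $ i) - real_of_int p - \<theta> $ i\<bar> \<le> 1 / real b ^ ?L" for i
      by (metis block_point_approx)
    then obtain p where p: "\<And>i. \<bar>real b ^ ?N * block_point b w (\<theta> $ i) (t $ i) - real_of_int (p i) - \<theta> $ i\<bar> \<le> 1 / real b ^ ?L"
      by metis
    have "\<nu> (real_of_int (int b ^ ?N) *\<^sub>R ?x - int_vec (\<chi> i. p i) - \<theta>) \<le> 1 / real b ^ ?L * K"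
      unfolding K_def by (rule is_norm_le_sum[OF \<nu>]) (use p in \<open>simp add: int_vec_def\<close>)
    also have "1 / real b ^ ?L * K \<le> c * Q powr (- w)"
    proof -
      let ?l = "w * growth w ^ (k + 3)"
      have "1 / real b ^ ?L = real b powr (- real ?L)" using b1 by (simp add: powr_minus powr_realpow field_simps)
      also have "\<dots> \<le> real b powr (- (?l + k))"
        using block_length_bounds(1)[OF w, of k] b1 by (intro powr_mono) auto
      finally have 1: "1 / real b ^ ?L \<le> real b powr (- (?l + k))" .
      have "K * real b / c < real b ^ k" using k0 power_increasing[OF k0k, of "real b"] b1 by linarith
      then have "K \<le> c * (real b powr k / real b)"
        using c b1 by (simp add: powr_realpow field_simps)
      also have "\<dots> = c * real b powr (real k - 1)" using b1 by (simp add: powr_diff)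
      finally have 2: "K \<le> c * real b powr (real k - 1)" .
      have "1 / real b ^ ?L * K \<le> real b powr (- (?l + k)) * (c * real b powr (real k - 1))"
        using 1 2 K by (intro mult_mono) auto
      also have "\<dots> = c * real b powr (- (?l + 1))"
        by (simp add: powr_add[symmetric])
      also have "\<dots> \<le> c * real b powr (- w * log b Q)"
      proof -
        have "log b Q \<le> growth w ^ (k + 3) + 1"
          using n(2) k(2) block_start_bounds(2)[OF w, of "Suc k"] by (simp add: eval_nat_numeral)
        then have "w * log b Q \<le> w * (growth w ^ (k + 3) + 1)" using w by (intro mult_left_mono) auto
        then have "w * log b Q \<le> ?l + 1" using w by (simp add: distrib_left)
        then show ?thesis using c b1 by (intro mult_left_mono powr_mono) auto
      qed
      also have "real b powr (- w * log b Q) = (real b powr log b Q) powr (- w)"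
        by (simp add: powr_powr mult.commute)
      also have "real b powr log b Q = Q" using b1 Q1 by simp
      finally show ?thesis .
    qed
    finally have "\<nu> (real_of_int (int b ^ ?N) *\<^sub>R ?x - int_vec (\<chi> i. p i) - \<theta>) \<le> c * Q powr (- w)" .
    moreover have "1 \<le> int b ^ ?N" using b by simp
    moreover have "real_of_int (int b ^ ?N) \<le> Q" using NQ by simp
    ultimately show "\<exists>q\<in>{int b ^ N |N. 1 \<le> N}. \<exists>p :: int ^ 'm. 1 \<le> q \<and> real_of_int q \<le> Q \<and>
      \<nu> (real_of_int q *\<^sub>R ?x - int_vec p - \<theta>) \<le> c * Q powr (- w)"
      using N1 by blast
  qed
qed

text \<open>The constant depends only on the density of the free positions and not on \<theta>, so
  it serves all coordinates at once.\<close>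

lemma block_point_inverse_hoelder:
  assumes "\<sigma> < ((1 - w) / (1 + w))\<^sup>2" "0 < \<sigma>"
  obtains K where "K \<ge> 0" "\<And>\<theta> t t'. 0 \<le> t \<Longrightarrow> t < 1 \<Longrightarrow> 0 \<le> t' \<Longrightarrow> t' < 1 \<Longrightarrow>
    \<bar>t - t'\<bar> \<le> K * \<bar>block_point b w \<theta> t - block_point b w \<theta> t'\<bar> powr \<sigma>"
proof -
  obtain C where C: "\<And>n. \<sigma> * real n - C \<le> free_count (free_pos w) n"
    by (rule free_count_lower_density[OF w assms(1)]) (use assms in auto)
  show ?thesis
    by (rule that[of "3 * real b powr (C + \<sigma>)"])
      (use expansion_splice_inverse_hoelder[OF b block_digits_bounds assms(2) C] in \<open>auto simp: block_point_def\<close>)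
qed

text \<open>Equal images have distance 0, and \<open>0 powr \<sigma> = 0\<close>, so the Hoelder
  bound leaves no room between \<open>t\<close> and \<open>t'\<close>.\<close>

lemma inj_on_block_point: "inj_on (block_point b w \<theta>) {0..<1}"
proof (rule inj_onI)
  fix t t' :: real assume t: "t \<in> {0..<1}" "t' \<in> {0..<1}" "block_point b w \<theta> t = block_point b w \<theta> t'"
  have "0 < ((1 - w) / (1 + w))\<^sup>2" using w by simp
  then obtain \<sigma> where \<sigma>: "0 < \<sigma>" "\<sigma> < ((1 - w) / (1 + w))\<^sup>2" using dense by blast
  obtain K where "K \<ge> 0" "\<And>\<theta> t t'. 0 \<le> t \<Longrightarrow> t < 1 \<Longrightarrow> 0 \<le> t' \<Longrightarrow> t' < 1 \<Longrightarrow>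
    \<bar>t - t'\<bar> \<le> K * \<bar>block_point b w \<theta> t - block_point b w \<theta> t'\<bar> powr \<sigma>"
    using block_point_inverse_hoelder[OF \<sigma>(2,1)] by blast
  from this(2)[of t t' \<theta>] t show "t = t'" by simp
qed

text \<open>In the direction of a coordinate \<open>i\<close> with \<open>a $ i \<noteq> 0\<close>
  only one summand of the inner product varies, and it does so injectively. The coordinate maps are
  Borel, being series of digit functions, so the set is measurable.\<close>

lemma negligible_block_point_vimage_hyperplane:
  fixes \<theta> :: "real ^ 'm"
  assumes "affine_hyperplane H"
  shows "negligible {t. (\<forall>i. 0 \<le> t $ i \<and> t $ i < 1) \<and> (\<chi> i. block_point b w (\<theta> $ i) (t $ i)) \<in> H}"
    (is "negligible ?S")
proof -
  obtain a c where ac: "a \<noteq> 0" "H = {x. a \<bullet> x = c}" using assms by (auto simp: affine_hyperplane_def)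
  obtain i where i: "a $ i \<noteq> 0" using ac(1) by (auto simp: vec_eq_iff)
  have S: "?S = {t. (\<forall>i. 0 \<le> t $ i \<and> t $ i < 1) \<and> (\<Sum>i\<in>UNIV. a $ i * block_point b w (\<theta> $ i) (t $ i)) = c}"
    unfolding ac by (simp add: inner_vec_def)
  show ?thesis
  proof (rule negligible_if_transversal[where v = "axis i 1"])
    have [measurable]: "(\<lambda>t :: real ^ 'm. t $ j) \<in> borel_measurable borel" for j
      by (intro borel_measurable_continuous_onI continuous_intros)
    have "(\<lambda>t. block_point b w (\<theta> $ j) t) \<in> borel_measurable borel" for j
      unfolding block_point_def by (rule borel_measurable_expansion_splice[OF b block_digits_bounds])
    then have [measurable]: "(\<lambda>t :: real ^ 'm. block_point b w (\<theta> $ j) (t $ j)) \<in> borel_measurable borel" for j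
      by (rule measurable_compose[rotated]) measurable
    have "{t \<in> space borel. (\<forall>i. 0 \<le> t $ i \<and> t $ i < 1) \<and>
        (\<Sum>i\<in>UNIV. a $ i * block_point b w (\<theta> $ i) (t $ i)) = c} \<in> sets borel"
      by measurable
    then show "?S \<in> sets lebesgue" unfolding S by simp
  next
    have "norm t \<le> real CARD('m)" if "t \<in> ?S" for t
    proof -
      have "norm t \<le> (\<Sum>i\<in>UNIV. \<bar>t $ i\<bar>)" by (rule norm_le_l1_cart)
      also have "\<dots> \<le> (\<Sum>i\<in>(UNIV :: 'm set). 1)" using that by (intro sum_mono) (auto intro: less_imp_le)
      finally show ?thesis by simp
    qed
    then show "bounded ?S" unfolding bounded_iff by blast
  next
    fix x r assume x: "x \<in> ?S" "x + r *\<^sub>R axis i 1 \<in> ?S"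
    let ?y = "x + r *\<^sub>R axis i 1"
    let ?f = "\<lambda>t j. a $ j * block_point b w (\<theta> $ j) (t $ j)"
    have "sum (?f x) UNIV = sum (?f ?y) UNIV" using x unfolding S by simp
    moreover have "sum (?f x) (UNIV - {i}) = sum (?f ?y) (UNIV - {i})"
      by (rule sum.cong) (auto simp: axis_def)
    moreover have "sum (?f t) UNIV = ?f t i + sum (?f t) (UNIV - {i})" for t
      by (rule sum.remove) auto
    note this[of x] this[of ?y]
    ultimately have "?f x i = ?f ?y i" by linarith
    then have "block_point b w (\<theta> $ i) (x $ i) = block_point b w (\<theta> $ i) (?y $ i)" using i by simp
    moreover have "x $ i \<in> {0..<1}" "?y $ i \<in> {0..<1}" 
      using x by (simp_all only: mem_Collect_eq atLeastLessThan_iff simp_thms)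
    ultimately have "x $ i = ?y $ i" using inj_onD[OF inj_on_block_point] by blast
    then show "r = 0" by simp
  qed
qed

section \<open>The dimension bound off the hyperplanes\<close>

lemma hausdorff_dim_singular_set_base_ge_aux:
  fixes \<nu> :: "real ^ 'm \<Rightarrow> real" and \<theta> :: "real ^ 'm"
  assumes \<nu>: "is_norm \<nu>" and \<H>: "countable \<H>" "\<forall>H\<in>\<H>. affine_hyperplane H"
    and \<sigma>: "\<sigma> < ((1 - w) / (1 + w))\<^sup>2" "0 < \<sigma>"
  shows "ereal (\<sigma> * CARD('m)) \<le> hausdorff_dim (singular_set_base b \<nu> \<theta> w - \<Union>\<H>)"
proof -
  define f where "f t = (\<chi> i. block_point b w (\<theta> $ i) (t $ i))" for t :: "real ^ 'm"
  define B where "B = {t :: real ^ 'm. \<forall>i. 0 \<le> t $ i \<and> t $ i < 1}"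
  define Z where "Z = (\<Union>H\<in>\<H>. {t. (\<forall>i. 0 \<le> t $ i \<and> t $ i < 1) \<and> f t \<in> H})"
  obtain K where K: "K \<ge> 0" "\<And>\<theta> t t'. 0 \<le> t \<Longrightarrow> t < 1 \<Longrightarrow> 0 \<le> t' \<Longrightarrow> t' < 1 \<Longrightarrow>
    \<bar>t - t'\<bar> \<le> K * \<bar>block_point b w \<theta> t - block_point b w \<theta> t'\<bar> powr \<sigma>"
    using block_point_inverse_hoelder[OF \<sigma>] by blast
  have "negligible Z" unfolding Z_def f_def
    by (rule negligible_countable_Union)
      (use \<H> negligible_block_point_vimage_hyperplane in auto)
  moreover have "\<not> negligible B"
  proof
    assume "negligible B"
    \<comment> \<open>The half-open cube contains this closed box, for which negligibility means
      having empty interior.\<close>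
    then have "negligible (cbox (0 :: real ^ 'm) (\<chi> i. 1 / 2))"
    proof (rule negligible_subset)
      have "0 \<le> t $ i \<and> t $ i < 1" if "t \<in> cbox (0 :: real ^ 'm) (\<chi> i. 1 / 2)" for t i
        using that[unfolded mem_box_cart, rule_format, of i] by simp
      then show "cbox (0 :: real ^ 'm) (\<chi> i. 1 / 2) \<subseteq> B" by (auto simp: B_def)
    qed
    then show False unfolding negligible_interval by (simp add: interval_eq_empty_cart)
  qed
  ultimately have nn: "\<not> negligible (B - Z)"
    by (metis Diff_partition Un_Diff_cancel negligible_Un negligible_subset sup_ge2)
  have "ereal (\<sigma> * DIM(real ^ 'm)) \<le> hausdorff_dim (f ` (B - Z))"
  proof (rule hausdorff_dim_image_ge[OF \<sigma>(2) _ _ nn])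
    \<comment> \<open>The Euclidean distance is at most the sum of the coordinate distances, so the
      one-dimensional constant is multiplied by the number of coordinates.\<close>
    show "0 \<le> real CARD('m) * K" using K by simp
    fix t t' assume t: "t \<in> B - Z" "t' \<in> B - Z"
    have "dist t t' \<le> (\<Sum>i\<in>UNIV. \<bar>(t - t') $ i\<bar>)" unfolding dist_norm by (rule norm_le_l1_cart)
    also have "\<dots> \<le> (\<Sum>i\<in>(UNIV :: 'm set). K * dist (f t) (f t') powr \<sigma>)"
    proof (rule sum_mono)
      fix i
      have "\<bar>(t - t') $ i\<bar> \<le> K * \<bar>(f t - f t') $ i\<bar> powr \<sigma>"
        using K(2)[of "t $ i" "t' $ i"] t by (auto simp: f_def B_def)
      also have "\<dots> \<le> K * dist (f t) (f t') powr \<sigma>"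
        using K \<sigma> component_le_norm_cart[of "f t - f t'" i]
        by (intro mult_left_mono powr_mono2) (auto simp: dist_norm)
      finally show "\<bar>(t - t') $ i\<bar> \<le> K * dist (f t) (f t') powr \<sigma>" .
    qed
    finally show "dist t t' \<le> real CARD('m) * K * dist (f t) (f t') powr \<sigma>" by (simp add: mult.assoc)
  qed
  also have "\<dots> \<le> hausdorff_dim (singular_set_base b \<nu> \<theta> w - \<Union>\<H>)"
  proof (rule hausdorff_dim_mono)
    show "f ` (B - Z) \<subseteq> singular_set_base b \<nu> \<theta> w - \<Union>\<H>"
      using block_point_mem_singular_set_base[OF \<nu>, of \<theta>] by (auto simp: f_def B_def Z_def)
  qed
  finally show ?thesis by simp
qed

text \<open>The limit of the previous bound as \<sigma> increases to the density: a smaller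
  dimension would be a real number \<open>d\<close>, and some \<sigma> fits strictly between
  \<open>d / ?m\<close> and the density.\<close>

lemma hausdorff_dim_singular_set_base_ge:
  fixes \<nu> :: "real ^ 'm \<Rightarrow> real" and \<theta> :: "real ^ 'm"
  assumes "is_norm \<nu>" and "countable \<H>" "\<forall>H\<in>\<H>. affine_hyperplane H"
  shows "ereal (CARD('m) * ((1 - w) / (1 + w))\<^sup>2) \<le> hausdorff_dim (singular_set_base b \<nu> \<theta> w - \<Union>\<H>)"
    (is "ereal (?m * ?r) \<le> ?D")
proof (rule ccontr)
  assume less: "\<not> ?thesis"
  moreover have "0 \<le> ?D" by (rule hausdorff_dim_nonneg)
  ultimately obtain d where d: "?D = ereal d" "0 \<le> d" "d < ?m * ?r"
    by (cases ?D) auto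
  then have "d / ?m < ?r" by (simp add: field_simps)
  then obtain \<sigma> where \<sigma>: "d / ?m < \<sigma>" "\<sigma> < ?r" using dense by blast
  moreover have "0 \<le> d / ?m" using d by simp
  ultimately have "ereal (\<sigma> * ?m) \<le> ereal d"
    using hausdorff_dim_singular_set_base_ge_aux[OF assms, of \<sigma> \<theta>] d(1) by auto
  with \<sigma> show False by (simp add: field_simps)
qed

end

lemma singular_set_base_subset: "singular_set_base b \<nu> \<theta> w \<subseteq> singular_set \<nu> \<theta> w"
  unfolding singular_set_base_def singular_set_def singular_set_on_def by blast

theorem theorem2p4:
  fixes \<nu> :: "real ^ 'm \<Rightarrow> real"
    and b :: nat
    and \<theta> :: "real ^ 'm"
    and \<H> :: "(real ^ 'm) set set"
    and \<T> :: "(real ^ 'm) set"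
  assumes "is_norm \<nu>"
    and "b \<ge> 2"
    and "countable \<H>"
    and "\<forall>H\<in>\<H>. affine_hyperplane H"
    and "\<T> = \<Union>\<H>"
  shows "(\<forall>w::real. 0 \<le> w \<and> w < 1 \<longrightarrow>
            hausdorff_dim (singular_set \<nu> \<theta> w - \<T>)
              \<ge> hausdorff_dim (singular_set_base b \<nu> \<theta> w - \<T>) \<and>
            hausdorff_dim (singular_set_base b \<nu> \<theta> w - \<T>)
              \<ge> ereal (real CARD('m) * ((1 - w) / (1 + w))\<^sup>2)) \<and>
         hausdorff_dim (singular_set \<nu> \<theta> (1 / real CARD('m)) - \<T>)
           \<ge> hausdorff_dim (singular_set_base b \<nu> \<theta> (1 / real CARD('m)) - \<T>) \<and>
         hausdorff_dim (singular_set_base b \<nu> \<theta> (1 / real CARD('m)) - \<T>)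
           \<ge> ereal (real CARD('m) * (1 - 2 / (real CARD('m) + 1))\<^sup>2)"
proof -
  let ?m = "real CARD('m)"
  have subset: "hausdorff_dim (singular_set_base b \<nu> \<theta> w - \<T>) \<le> hausdorff_dim (singular_set \<nu> \<theta> w - \<T>)" for w
    by (intro hausdorff_dim_mono Diff_mono singular_set_base_subset order_refl)
  have ge: "ereal (?m * ((1 - w) / (1 + w))\<^sup>2) \<le> hausdorff_dim (singular_set_base b \<nu> \<theta> w - \<T>)"
    if "0 \<le> w" "w < 1" for w
    unfolding \<open>\<T> = \<Union>\<H>\<close> using that assms by (intro hausdorff_dim_singular_set_base_ge)
  have "ereal (?m * (1 - 2 / (?m + 1))\<^sup>2) \<le> hausdorff_dim (singular_set_base b \<nu> \<theta> (1 / ?m) - \<T>)"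
  \<comment> \<open>In dimension 1 the exponent equals 1 and lies outside the range of
    \<open>ge\<close>, but then the claimed bound is 0.\<close>
  proof (cases "CARD('m) = 1")
    case True
    then show ?thesis by (simp add: hausdorff_dim_nonneg flip: zero_ereal_def)
  next
    case False
    then have m: "?m > 1" using zero_less_card_finite[where 'a = 'm] by linarith
    then have "1 - 1 / ?m = (?m - 1) / ?m" "1 + 1 / ?m = (?m + 1) / ?m" "1 - 2 / (?m + 1) = (?m - 1) / (?m + 1)"
      using m by (auto simp: divide_simps)
    then have "(1 - 1 / ?m) / (1 + 1 / ?m) = 1 - 2 / (?m + 1)" using m by simp
    with ge[of "1 / ?m"] m show ?thesis by simp
  qed
  with subset ge show ?thesis by blast
qed

end
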